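(* Let $\alpha>0$, $\gamma\ge0$, and real constants $\beta,\beta',\gamma',c_0>0,c_1$, and nonzero reals $(e_n)_{n\ge1}$. Let $P_0(v)=c_0+c_1(v-1)$ and for $n\ge1$ \[ P_n(v)=\frac{\alpha n+\gamma+\gamma'(v-1)}{e_n}P_{n-1}(v)+\frac{\beta+\beta'(v-1)}{e_n}(1-v)P_{n-1}'(v). \] Assume (i) $[v^k]P_n(v)\ge0$ for $k,n\ge0$, (ii) $P_n(1)>0$ for $n\ge0$, and (iii) $\beta>0$. Define $X_n$ by $\mathbb{E}(v^{X_n})=P_n(v)/P_n(1)$. Then: - if $\beta'=0$, $X_n$ converges in distribution to a Poisson distribution with parameter $\gamma'/\beta$; - if $\beta'<0$, $X_n$ converges in distribution to a negative binomial distribution with parameters $-\gamma'/\beta'$ and $-\beta'/(\beta-\beta')$, i.e. with probability generating function $\left(1+\frac{\beta'}{\beta}(v-1)\right)^{\gamma'/\beta'}$; - if $\beta'>0$, $\beta\ne\beta'$ and $\gamma'=\ell\beta'$ for some $\ell\in\{1,2,\dots\}$, then $X_n$ converges in distribution to the sum of $\ell$ independent Bernoulli random variables each with parameter $\beta'/\beta$. *)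

theory Defs
  imports "HOL-Probability.Probability" "HOL-Computational_Algebra.Polynomial"
begin

text \<open>
  Negative binomial distribution with real parameter \<open>r\<close> (the library only has integer \<open>r\<close>).
  Note that \<open>p\<close> is the base of the geometric factor, as opposed to the library's
  \<^const>\<open>neg_binomial_pmf\<close>, where it is \<open>1 - p\<close>. Thus the probability generating function is
  \<open>((1 - p) / (1 - p * v)) powr r\<close>. The definition is meaningful for \<open>r \<ge> 0\<close> and \<open>0 \<le> p < 1\<close>;
  \<open>r = 0\<close> gives the point mass at 0.
\<close>

definition real_neg_binomial_pmf :: "real \<Rightarrow> real \<Rightarrow> nat pmf" where
  "real_neg_binomial_pmf r p =
     embed_pmf (\<lambda>k. ((r + real k - 1) gchoose k) * (1 - p) powr r * p ^ k)"

lemma pmf_real_neg_binomial: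
  assumes "0 \<le> r" "0 \<le> p" "p < 1"
  shows "pmf (real_neg_binomial_pmf r p) k = ((r + real k - 1) gchoose k) * (1 - p) powr r * p ^ k"
proof -
  let ?f = "\<lambda>k. ((r + real k - 1) gchoose k) * (1 - p) powr r * p ^ k"
  have gb: "((r + real k - 1) gchoose k) = pochhammer r k / fact k" for k
    by (simp add: gbinomial_pochhammer' algebra_simps)
  have nonneg: "0 \<le> ?f k" for k
    unfolding gb using assms by (auto intro!: mult_nonneg_nonneg divide_nonneg_nonneg pochhammer_nonneg
      simp: pochhammer_prod prod_nonneg)
  have "(\<lambda>k. ((-r) gchoose k) * (-p) ^ k) sums (1 + (-p)) powr (-r)"
    by (rule gen_binomial_real) (use assms in auto)
  also have "(\<lambda>k. ((-r) gchoose k) * (-p) ^ k) = (\<lambda>k. ((r + real k - 1) gchoose k) * p ^ k)"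
    by (rule ext) (simp add: gbinomial_minus power_minus[of p])
  finally have "(\<lambda>k. (1 - p) powr r * (((r + real k - 1) gchoose k) * p ^ k)) sums
                  ((1 - p) powr r * (1 - p) powr (-r))"
    by (intro sums_mult) simp
  moreover have "(1 - p) powr r * (1 - p) powr (-r) = 1"
    using assms by (simp flip: powr_add)
  ultimately have "?f sums 1"
    by (simp add: mult_ac)
  then have "(\<Sum>k. ennreal (?f k)) = ennreal 1"
    using nonneg by (intro suminf_ennreal_eq)
  then have "(\<integral>\<^sup>+k. ennreal (?f k) \<partial>count_space UNIV) = 1"
    by (simp add: nn_integral_count_space_nat)
  with nonneg show ?thesis
    unfolding real_neg_binomial_pmf_def by (intro pmf_embed_pmf)
qed

text \<open>
  The library leaves \<^term>\<open>poisson_pmf 0\<close> unspecified; the Poisson distribution with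
  parameter 0 is the point mass at 0.
\<close>

definition poisson0_pmf :: "real \<Rightarrow> nat pmf" where
  "poisson0_pmf r = (if r = 0 then return_pmf 0 else poisson_pmf r)"

lemma pmf_poisson0:
  assumes "0 \<le> r"
  shows "pmf (poisson0_pmf r) k = r ^ k / fact k * exp (- r)"
  using assms by (cases k) (auto simp: poisson0_pmf_def)

definition bernoulli_sum_pmf :: "nat \<Rightarrow> real \<Rightarrow> nat pmf" where
  "bernoulli_sum_pmf l p =
     map_pmf (\<lambda>b. \<Sum>i<l. of_bool (b i)) (Pi_pmf {..<l} False (\<lambda>_. bernoulli_pmf p))"

definition nat_converges_in_dist :: "(nat \<Rightarrow> 'a measure) \<Rightarrow> (nat \<Rightarrow> 'a \<Rightarrow> nat) \<Rightarrow> nat pmf \<Rightarrow> bool" where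
  "nat_converges_in_dist M X L \<longleftrightarrow>
     weak_conv_m (\<lambda>n. distr (M n) borel (\<lambda>\<omega>. real (X n \<omega>)))
                 (distr (measure_pmf L) borel real)"

end

theory Submission
  imports Defs
begin

text \<open>
  Put \<open>Q\<^sub>n = P\<^sub>n / P\<^sub>n(1)\<close>. The recurrence says
  \<open>Q\<^sub>n = Q\<^bsub>n-1\<^esub> + (1 - v) R\<^bsub>n-1\<^esub> / (\<alpha> n + \<gamma>)\<close>, where
  \<open>R\<^sub>n = (\<beta> - \<beta>' + \<beta>' v) Q\<^sub>n' - \<gamma>' Q\<^sub>n\<close> measures how far \<open>Q\<^sub>n\<close> is from
  satisfying the differential equation of the limiting generating function.
  At \<open>v = 1\<close> the recurrence for the Taylor coefficients of \<open>Q\<^sub>n\<close> (the binomial moments) is triangular,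
  so they converge and the Taylor coefficients of \<open>R\<^sub>n\<close> there tend to 0. The binomial moments are
  also bounded by \<open>K^k\<close> uniformly in \<open>n\<close>, and since the coefficients of \<open>Q\<^sub>n\<close> are nonnegative the
  same bound holds for the Taylor coefficients at every \<open>v \<in> [0, 1]\<close>. Hence one can re-expand \<open>R\<^sub>n\<close> in
  finitely many short steps from 1 down to 0 (dominated convergence at each step), and all
  coefficients of \<open>R\<^sub>n\<close> tend to 0. So the point probabilities asymptotically satisfy the two-term
  recurrence of the limit law, and tightness fixes the normalisation.
\<close>

subsection \<open>Sequences and power series\<close>

text \<open>Each step moves \<open>b n\<close> towards \<open>u n\<close> by the fraction
  \<open>t n\<close>. Once \<open>t n < 1\<close>, the distance to \<open>l\<close> shrinks by the
  factor \<open>1 - t n \<le> exp (- t n)\<close>, up to the error of \<open>u n\<close>; since the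
  sum of \<open>t\<close> diverges, the initial distance is forgotten.\<close>

lemma relaxation_tendsto:
  fixes b t u :: "nat \<Rightarrow> real"
  assumes rec: "\<And>n. b (Suc n) = (1 - t n) * b n + t n * u n"
    and t0: "\<And>n. t n \<ge> 0" and t_lim: "t \<longlonglongrightarrow> 0" and div: "\<not> summable t"
    and u: "u \<longlonglongrightarrow> l"
  shows "b \<longlonglongrightarrow> l"
proof (rule LIMSEQ_I)
  fix r :: real assume r: "r > 0"
  have "eventually (\<lambda>n. t n < 1) sequentially"
    using t_lim by (rule order_tendstoD) simp
  moreover have "eventually (\<lambda>n. \<bar>u n - l\<bar> < r / 2) sequentially"
    using tendstoD[OF u, of "r / 2"] r by (simp add: dist_real_def)
  ultimately have "eventually (\<lambda>n. t n < 1 \<and> \<bar>u n - l\<bar> < r / 2) sequentially"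
    by eventually_elim simp
  then obtain N where N: "\<And>n. n \<ge> N \<Longrightarrow> t n < 1 \<and> \<bar>u n - l\<bar> < r / 2"
    by (auto simp: eventually_sequentially)
  define y where "y = \<bar>b N - l\<bar>"
  have bound: "\<bar>b (N + m) - l\<bar> \<le> y * exp (- (\<Sum>i<m. t (N + i))) + r / 2" for m
  proof (induction m)
    case 0
    then show ?case using r by (simp add: y_def)
  next
    case (Suc m)
    let ?t = "t (N + m)" and ?E = "y * exp (- (\<Sum>i<m. t (N + i)))"
    have t: "0 \<le> ?t" "?t < 1" and u': "\<bar>u (N + m) - l\<bar> < r / 2"
      using t0 N[of "N + m"] by auto
    have "\<bar>b (N + Suc m) - l\<bar> = \<bar>(1 - ?t) * (b (N + m) - l) + ?t * (u (N + m) - l)\<bar>"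
      by (simp add: rec algebra_simps)
    also have "\<dots> \<le> (1 - ?t) * \<bar>b (N + m) - l\<bar> + ?t * \<bar>u (N + m) - l\<bar>"
      using t by (intro order_trans[OF abs_triangle_ineq]) (simp add: abs_mult)
    also have "\<dots> \<le> (1 - ?t) * (?E + r / 2) + ?t * (r / 2)"
      using t u' Suc.IH by (intro add_mono mult_left_mono) auto
    also have "\<dots> = (1 - ?t) * ?E + r / 2" by (simp add: algebra_simps)
    also have "(1 - ?t) * ?E \<le> exp (- ?t) * ?E"
      using exp_ge_add_one_self[of "- ?t"] by (intro mult_right_mono) (auto simp: y_def)
    also have "exp (- ?t) * ?E = y * exp (- (\<Sum>i<Suc m. t (N + i)))"
      by (simp add: exp_diff exp_minus field_simps)
    finally show ?case by simp
  qed
  have "\<not> summable (\<lambda>i. t (N + i))"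
    using div summable_iff_shift[of t N] by (simp add: add.commute)
  then have "\<not> (\<forall>m. (\<Sum>i<m. t (N + i)) \<le> B)" for B
    using t0 by (meson summableI_nonneg_bounded)
  then have large: "\<exists>m. (\<Sum>i<m. t (N + i)) > B" for B
    by (meson not_le)
  \<comment> \<open>This threshold leaves at most \<open>y * r / (2 * y + 1) < r / 2\<close> of the
    initial distance; the \<open>+ 1\<close> keeps the logarithm meaningful when
    \<open>y = 0\<close>.\<close>
  obtain m where m: "(\<Sum>i<m. t (N + i)) > ln ((2 * y + 1) / r)"
    using large by blast
  have "\<bar>b n - l\<bar> < r" if n: "n \<ge> N + m" for n
  proof -
    define k where "k = n - N"
    have k: "n = N + k" "m \<le> k" using n by (auto simp: k_def)
    have "(\<Sum>i<m. t (N + i)) \<le> (\<Sum>i<k. t (N + i))"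
      using k t0 by (intro sum_mono2) auto
    then have "exp (- (\<Sum>i<k. t (N + i))) \<le> exp (- ln ((2 * y + 1) / r))"
      using m by simp
    also have "\<dots> = r / (2 * y + 1)"
    proof -
      have "(2 * y + 1) / r > 0" using r by (intro divide_pos_pos add_nonneg_pos) (auto simp: y_def)
      then show ?thesis by (simp add: exp_minus exp_ln del: zero_less_divide_iff)
    qed
    finally have "y * exp (- (\<Sum>i<k. t (N + i))) \<le> y * (r / (2 * y + 1))"
      by (intro mult_left_mono) (auto simp: y_def)
    also have "\<dots> < r / 2"
      using r by (simp add: y_def field_simps add_pos_nonneg)
    finally show ?thesis using bound[of k] k by simp
  qed
  then show "\<exists>no. \<forall>n\<ge>no. norm (b n - l) < r" by auto
qed

text \<open>Once the coefficients below \<open>n\<close> agree, the difference of the two series can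
  be divided by \<open>x ^ n\<close>. The quotient vanishes for small nonzero \<open>x\<close>, and
  its limit at 0 is the difference of the coefficients of order \<open>n\<close>.\<close>

lemma powser_coeffs_unique:
  fixes a b :: "nat \<Rightarrow> real"
  assumes r: "r > 0"
    and a: "\<And>x. \<bar>x\<bar> < r \<Longrightarrow> (\<lambda>n. a n * x ^ n) sums f x"
    and b: "\<And>x. \<bar>x\<bar> < r \<Longrightarrow> (\<lambda>n. b n * x ^ n) sums f x"
  shows "a n = b n"
proof (induction n rule: less_induct)
  case (less n)
  have "(\<lambda>k. (a (k + n) - b (k + n)) * x ^ k) sums 0" if x: "x \<noteq> 0" "norm x < r" for x :: real
  proof -
    have "(\<lambda>k. a k * x ^ k - b k * x ^ k) sums (f x - f x)"
      using x by (intro sums_diff a b) auto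
    then have "(\<lambda>k. (a k - b k) * x ^ k) sums 0"
      by (simp add: algebra_simps)
    then have "(\<lambda>k. (a (k + n) - b (k + n)) * x ^ (k + n)) sums 0"
      by (subst sums_zero_iff_shift) (use less in auto)
    then have "(\<lambda>k. (a (k + n) - b (k + n)) * x ^ (k + n) / x ^ n) sums (0 / x ^ n)"
      by (rule sums_divide)
    then show ?thesis using x by (simp add: power_add)
  qed
  then have "((\<lambda>_. 0) \<longlongrightarrow> a (0 + n) - b (0 + n)) (at (0::real))"
    by (rule powser_limit_0_strong[OF r])
  then show ?case
    using LIM_unique tendsto_const by fastforce
qed

subsection \<open>Taylor coefficients of polynomials\<close>

text \<open>\<open>pcompose p [:c, 1:]\<close> is p(c + x), so its coefficients are the Taylor
  coefficients of \<open>p\<close> at \<open>c\<close>. All expansions at a centre are encoded this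
  way.\<close>

lemma coeff_pcompose_shift:
  fixes p :: "real poly"
  shows "coeff (pcompose p [:c, 1:]) j = (\<Sum>k\<le>degree p. coeff p k * (of_nat (k choose j) * c ^ (k - j)))"
proof -
  have pow: "pcompose (q ^ k) r = pcompose q r ^ k" for q r :: "real poly" and k
    by (induction k) (simp_all add: pcompose_1 pcompose_mult)
  have "pcompose p [:c, 1:] = pcompose (\<Sum>k\<le>degree p. monom (coeff p k) k) [:c, 1:]"
    by (simp add: poly_as_sum_of_monoms)
  also have "\<dots> = (\<Sum>k\<le>degree p. smult (coeff p k) ([:c, 1:] ^ k))"
    by (simp add: pcompose_sum pcompose_smult monom_altdef pow pcompose_pCons)
  also have "coeff \<dots> j = (\<Sum>k\<le>degree p. coeff p k * (of_nat (k choose j) * c ^ (k - j)))"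
  proof -
    have "coeff ([:c, 1:] ^ k) j = of_nat (k choose j) * c ^ (k - j)" for k
    proof (cases "j \<le> k")
      case True
      then show ?thesis by (simp add: coeff_linear_poly_power)
    next
      case False
      then show ?thesis by (simp add: coeff_eq_0 degree_linear_power)
    qed
    then show ?thesis by (simp add: coeff_sum)
  qed
  finally show ?thesis .
qed

text \<open>Each Taylor coefficient at \<open>v - h\<close> is a sum over all Taylor coefficients at
  \<open>v\<close>. For \<open>h \<le> 1 / (4 * K)\<close> its terms are dominated, uniformly in
  \<open>n\<close>, by a geometric series of ratio 1/2, so Tannery's theorem exchanges limit and
  sum.\<close>

lemma taylor_coeff_tendsto_0_step:
  fixes f :: "nat \<Rightarrow> real poly"
  assumes K: "K > 0" and h: "0 \<le> h" "h \<le> 1 / (4 * K)"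
    and bound: "\<And>n k. \<bar>coeff (pcompose (f n) [:v, 1:]) k\<bar> \<le> C * K ^ k"
    and lim: "\<And>k. (\<lambda>n. coeff (pcompose (f n) [:v, 1:]) k) \<longlonglongrightarrow> 0"
  shows "(\<lambda>n. coeff (pcompose (f n) [:v - h, 1:]) j) \<longlonglongrightarrow> 0"
proof -
  define a where "a = (\<lambda>n k. coeff (pcompose (f n) [:v, 1:]) k)"
  have a_bound: "\<bar>a n k\<bar> \<le> C * K ^ k" for n k
    using bound by (simp add: a_def)
  define g where "g = (\<lambda>k n. a n k * (of_nat (k choose j) * (- h) ^ (k - j)))"
  have C: "C \<ge> 0" using bound[of 0 0] by simp
  have "coeff (pcompose (f n) [:v - h, 1:]) j = (\<Sum>k. g k n)" for n
  proof -
    have "pcompose (f n) [:v - h, 1:] = pcompose (pcompose (f n) [:v, 1:]) [:- h, 1:]"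
      by (simp add: pcompose_assoc[symmetric] pcompose_pCons)
    also have "coeff \<dots> j = (\<Sum>k\<le>degree (pcompose (f n) [:v, 1:]). g k n)"
      by (simp only: coeff_pcompose_shift g_def a_def)
    also have "\<dots> = (\<Sum>k. g k n)"
      by (rule suminf_finite[symmetric]) (auto simp: g_def a_def coeff_eq_0)
    finally show ?thesis .
  qed
  moreover have "(\<lambda>n. \<Sum>k. g k n) \<longlonglongrightarrow> (\<Sum>k. 0)"
  proof (rule tannerys_theorem[THEN conjunct2, THEN conjunct2])
    fix k
    show "g k \<longlonglongrightarrow> 0"
      unfolding g_def a_def by (rule tendsto_mult_left_zero[OF lim])
  next
    \<comment> \<open>The growth \<open>K ^ k\<close> of the coefficients and the bound
      \<open>2 ^ k\<close> for the binomial coefficient are outweighed by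
      \<open>(1 / (4 * K)) ^ (k - j)\<close>.\<close>
    have "norm (g k n) \<le> C * (4 * K) ^ j * (1 / 2) ^ k" for k n
    proof (cases "j \<le> k")
      case True
      have "norm (g k n) = \<bar>a n k\<bar> * (of_nat (k choose j) * h ^ (k - j))"
        using h by (simp add: g_def abs_mult power_abs)
      also have "\<dots> \<le> (C * K ^ k) * (2 ^ k * (1 / (4 * K)) ^ (k - j))"
      proof (intro mult_mono a_bound power_mono)
        have "k choose j \<le> 2 ^ k" by (rule binomial_le_pow2)
        then show "real (k choose j) \<le> 2 ^ k"
          using of_nat_mono[of "k choose j" "2 ^ k", where ?'a = real] by simp
      qed (use h C K in auto)
      also have "(1 / (4 * K)) ^ (k - j) = (4 * K) ^ j / (4 * K) ^ k"
        using K True by (simp add: power_diff power_divide)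
      also have "(C * K ^ k) * (2 ^ k * ((4 * K) ^ j / (4 * K) ^ k)) = C * (4 * K) ^ j * (1 / 2) ^ k"
      proof -
        have "(4::real) ^ k = 2 ^ k * 2 ^ k" by (simp flip: power_mult_distrib)
        then show ?thesis using K by (simp add: power_mult_distrib power_divide field_simps)
      qed
      finally show ?thesis .
    next
      case False
      then show ?thesis using C K by (simp add: g_def binomial_eq_0)
    qed
    then show "\<forall>\<^sub>F (k, n) in sequentially \<times>\<^sub>F sequentially.
                 norm (g k n) \<le> C * (4 * K) ^ j * (1 / 2) ^ k"
      by (simp add: case_prod_unfold)
  qed (auto intro!: summable_mult summable_geometric)
  ultimately show ?thesis by simp
qed

text \<open>The admissible step length depends neither on the order nor on the centre, because the
  bound is uniform over \<open>{0..1}\<close>. Hence \<open>m > 4 * K\<close> equal steps lead from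
  1 to 0.\<close>

lemma taylor_coeff_tendsto_0_transport:
  fixes f :: "nat \<Rightarrow> real poly"
  assumes K: "K > 0"
    and bound: "\<And>n v k. v \<in> {0..1} \<Longrightarrow> \<bar>coeff (pcompose (f n) [:v, 1:]) k\<bar> \<le> C * K ^ k"
    and lim: "\<And>k. (\<lambda>n. coeff (pcompose (f n) [:1, 1:]) k) \<longlonglongrightarrow> 0"
  shows "(\<lambda>n. coeff (f n) k) \<longlonglongrightarrow> 0"
proof -
  obtain m :: nat where m: "real m > 4 * K" using reals_Archimedean2 by blast
  have m0: "real m > 0" using m K by simp
  have "\<forall>k. (\<lambda>n. coeff (pcompose (f n) [:1 - real i / real m, 1:]) k) \<longlonglongrightarrow> 0" if "i \<le> m" for i
    using that
  proof (induction i)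
    case 0
    then show ?case using lim by simp
  next
    case (Suc i)
    have i: "1 - real i / real m \<in> {0..1}" using Suc.prems m0 by (simp add: field_simps)
    have h: "1 / real m \<le> 1 / (4 * K)" using m K by (intro divide_left_mono) auto
    have eq: "1 - real (Suc i) / real m = (1 - real i / real m) - 1 / real m"
      by (simp add: add_divide_distrib)
    show ?case
      unfolding eq
      by (intro allI taylor_coeff_tendsto_0_step[OF K _ h bound[OF i]]) (use Suc m0 in auto)
  qed
  from this[of m] show ?thesis using m0 by simp
qed

text \<open>The \<open>R\<^sub>n\<close> of the overview. Near 1, zero defect with value 1 at 1 is
  solved by exp(\<gamma>'/\<beta> (v - 1)) if \<beta>' = 0, and by (1 + \<beta>'/\<beta> (v - 1)) to
  the power \<gamma>'/\<beta>' otherwise.\<close>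

definition pgf_defect :: "real \<Rightarrow> real \<Rightarrow> real \<Rightarrow> real poly \<Rightarrow> real poly" where
  "pgf_defect \<beta> \<beta>' \<gamma>' q = [:\<beta> - \<beta>', \<beta>':] * pderiv q - smult \<gamma>' q"

text \<open>At \<open>v = 1\<close> the leading factor is \<beta>, which yields the recurrence of
  the binomial moments; at \<open>v = 0\<close> it is \<beta> - \<beta>', which yields that of the
  point probabilities.\<close>

lemma coeff_pgf_defect_shift:
  "coeff (pcompose (pgf_defect \<beta> \<beta>' \<gamma>' q) [:v, 1:]) k =
     (\<beta> - \<beta>' + \<beta>' * v) * real (Suc k) * coeff (pcompose q [:v, 1:]) (Suc k)
     + (\<beta>' * real k - \<gamma>') * coeff (pcompose q [:v, 1:]) k"
proof -
  let ?s = "pcompose q [:v, 1:]"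
  have "pderiv ?s = pcompose (pderiv q) [:v, 1:]"
    by (simp add: pderiv_pcompose pderiv_pCons)
  then have "pcompose (pgf_defect \<beta> \<beta>' \<gamma>' q) [:v, 1:] =
      [:\<beta> - \<beta>' + \<beta>' * v, \<beta>':] * pderiv ?s - smult \<gamma>' ?s"
    by (simp only: pgf_defect_def pcompose_diff pcompose_mult pcompose_smult)
      (simp add: pcompose_pCons mult.commute)
  then show ?thesis
    unfolding \<open>pcompose (pgf_defect _ _ _ _) _ = _\<close>
    by (cases k) (simp_all add: coeff_pderiv algebra_simps)
qed

lemma coeff_pgf_defect:
  "coeff (pgf_defect \<beta> \<beta>' \<gamma>' q) k =
     (\<beta> - \<beta>') * real (Suc k) * coeff q (Suc k) + (\<beta>' * real k - \<gamma>') * coeff q k"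
  using coeff_pgf_defect_shift[of \<beta> \<beta>' \<gamma>' q 0 k] by simp

lemma pmf_nat_sums: "pmf p sums 1" for p :: "nat pmf"
  using sums_integral_count_space_nat[OF integrable_pmf[where M = p and X = UNIV]] integral_pmf[where M = p and X = UNIV]
  by simp

subsection \<open>The normalised recurrence\<close>

text \<open>Division by the value at 1 has removed the constants \<open>e n\<close>. The step from
  \<open>Q n\<close> to \<open>Q (Suc n)\<close> carries the denominator of index
  \<open>Suc n\<close>.\<close>

locale pgf_recurrence =
  fixes \<alpha> \<beta> \<gamma> \<beta>' \<gamma>' :: real and Q :: "nat \<Rightarrow> real poly"
  assumes alpha_pos: "\<alpha> > 0" and beta_pos: "\<beta> > 0" and gamma_nonneg: "\<gamma> \<ge> 0"
    and degree_0: "degree (Q 0) \<le> 1"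
    and Q_Suc: "\<And>n. Q (Suc n) = Q n + smult (1 / (\<alpha> * real (Suc n) + \<gamma>))
                  ([:1, -1:] * pgf_defect \<beta> \<beta>' \<gamma>' (Q n))"
    and coeff_nonneg: "\<And>n k. coeff (Q n) k \<ge> 0"
    and poly_1: "\<And>n. poly (Q n) 1 = 1"
begin

section \<open>Binomial moments and their recurrence\<close>

definition weight :: "nat \<Rightarrow> real" where "weight n = \<alpha> * real (Suc n) + \<gamma>"

text \<open>For the generating function of X, this Taylor coefficient at 1 is the binomial moment
  E(X choose k), that is, the factorial moment divided by k!.\<close>

definition moment :: "nat \<Rightarrow> nat \<Rightarrow> real" where
  "moment n k = coeff (pcompose (Q n) [:1, 1:]) k"

lemma weight_pos: "weight n > 0"
  using alpha_pos gamma_nonneg by (simp add: weight_def add_pos_nonneg)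

lemma moment_0: "moment n 0 = 1"
  by (simp add: moment_def poly_1)

lemma shift_nonneg: "v \<ge> 0 \<Longrightarrow> coeff (pcompose (Q n) [:v, 1:]) k \<ge> 0"
  by (auto simp: coeff_pcompose_shift intro!: sum_nonneg mult_nonneg_nonneg coeff_nonneg)

lemma moment_nonneg: "moment n k \<ge> 0"
  by (simp add: moment_def shift_nonneg)

text \<open>Nonnegative coefficients make every Taylor coefficient increase with the centre, so
  bounds at 1 carry over to all of \<open>{0..1}\<close>.\<close>

lemma shift_le_moment:
  assumes "v \<in> {0..1}"
  shows "coeff (pcompose (Q n) [:v, 1:]) k \<le> moment n k"
  unfolding moment_def coeff_pcompose_shift using assms coeff_nonneg
  by (intro sum_mono mult_left_mono power_mono) auto

text \<open>At centre 1 the factor 1 - v becomes -x and shifts the order by one. Hence only the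
  orders \<open>Suc k\<close> and \<open>k\<close> enter, and the system is triangular.\<close>

lemma moment_Suc:
  "moment (Suc n) (Suc k) = moment n (Suc k)
     - (\<beta> * real (Suc k) * moment n (Suc k) + (\<beta>' * real k - \<gamma>') * moment n k) / weight n"
proof -
  have "pcompose (Q (Suc n)) [:1, 1:] = pcompose (Q n) [:1, 1:]
      + smult (1 / weight n) ([:0, -1:] * pcompose (pgf_defect \<beta> \<beta>' \<gamma>' (Q n)) [:1, 1:])"
    by (simp only: Q_Suc weight_def pcompose_add pcompose_smult pcompose_mult) (simp add: pcompose_pCons)
  then show ?thesis
    by (simp add: moment_def coeff_pgf_defect_shift)
qed

lemma degree_Q_le: "degree (Q n) \<le> Suc n"
proof (induction n)
  case 0
  then show ?case using degree_0 by simp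
next
  case (Suc n)
  have "degree (pgf_defect \<beta> \<beta>' \<gamma>' (Q n)) \<le> Suc n"
  proof (rule degree_le, intro allI impI)
    fix i assume "Suc n < i"
    then show "coeff (pgf_defect \<beta> \<beta>' \<gamma>' (Q n)) i = 0"
      using Suc by (simp add: coeff_pgf_defect coeff_eq_0)
  qed
  then have "degree ([:1, -1:] * pgf_defect \<beta> \<beta>' \<gamma>' (Q n)) \<le> Suc (Suc n)"
    by (intro order_trans[OF degree_mult_le]) simp
  then show ?case
    unfolding Q_Suc using Suc by (intro degree_add_le) (auto intro: order_trans[OF degree_smult_le])
qed

lemma moment_eq_0: "k > Suc n \<Longrightarrow> moment n k = 0"
  using degree_Q_le[of n] by (simp add: moment_def coeff_eq_0 degree_pcompose)

text \<open>Induction on \<open>n\<close> for all orders at once. The new moment is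
  \<open>1 - t\<close> times the old one plus \<open>t\<close> times a multiple \<open>c\<close> of
  the moment one order lower; for \<open>t \<le> 1\<close> this is a convex combination of
  quantities bounded by \<open>K ^ k\<close>.\<close>

lemma moment_bound: obtains K where "K \<ge> 1" "\<And>n k. moment n k \<le> K ^ k"
proof
  define C where "C = (\<bar>\<gamma>'\<bar> + \<bar>\<beta>'\<bar>) / \<beta>"
  \<comment> \<open>The summand \<open>C\<close> serves the case \<open>t \<le> 1\<close>,
    \<open>2 * \<beta> / \<alpha> * C\<close> the case \<open>t > 1\<close>, and
    \<open>moment 0 1\<close> the start of the induction.\<close>
  define K where "K = 1 + C + 2 * \<beta> / \<alpha> * C + moment 0 1"
  have C: "C \<ge> 0" using beta_pos by (simp add: C_def)
  have aC: "2 * \<beta> / \<alpha> * C \<ge> 0" using alpha_pos beta_pos C by simp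
  note nonnegs = C aC moment_nonneg[of 0 1]
  show K1: "K \<ge> 1" using nonnegs by (simp add: K_def)
  have CK: "C \<le> K" "2 * \<beta> / \<alpha> * C \<le> K" "moment 0 1 \<le> K"
    using nonnegs by (simp_all add: K_def)
  show "moment n k \<le> K ^ k" for n k
  proof (induction n arbitrary: k)
    case 0
    consider "k = 0" | "k = 1" | "k > Suc 0" by linarith
    then show ?case
      by cases (use K1 CK in \<open>simp_all add: moment_0 moment_eq_0\<close>)
  next
    case (Suc n)
    show ?case
    proof (cases k)
      case 0
      then show ?thesis by (simp add: moment_0)
    next
      case (Suc j)
      define t where "t = \<beta> * real (Suc j) / weight n"
      define c where "c = (\<gamma>' - \<beta>' * real j) / (\<beta> * real (Suc j))"
      have t0: "t \<ge> 0" using beta_pos weight_pos[of n] by (simp add: t_def)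
      have tc: "t * c = (\<gamma>' - \<beta>' * real j) / weight n"
        using beta_pos by (simp add: t_def c_def del: of_nat_Suc)
      have "moment (Suc n) (Suc j) = (1 - t) * moment n (Suc j) + (t * c) * moment n j"
        unfolding tc using weight_pos[of n]
        by (simp add: moment_Suc t_def field_simps del: of_nat_Suc)
      then have eq: "moment (Suc n) (Suc j) = (1 - t) * moment n (Suc j) + t * (c * moment n j)"
        by (simp only: mult.assoc)
      have "\<bar>\<gamma>' - \<beta>' * real j\<bar> \<le> \<bar>\<gamma>'\<bar> * real (Suc j) + \<bar>\<beta>'\<bar> * real (Suc j)"
        by (intro order_trans[OF abs_triangle_ineq4] add_mono) (auto simp: abs_mult algebra_simps)
      then have "c \<le> C"
        using beta_pos unfolding c_def C_def
        by (simp add: divide_simps) (simp add: algebra_simps)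
      then have cm: "c * moment n j \<le> C * K ^ j"
        using C moment_nonneg[of n j] Suc.IH[of j] by (intro mult_mono) auto
      show ?thesis
      proof (cases "t \<le> 1")
        case True
        have "c * moment n j \<le> K ^ Suc j"
          using cm CK(1) K1 by (intro order_trans[OF cm]) (simp add: mult_right_mono)
        then have "moment (Suc n) (Suc j) \<le> (1 - t) * K ^ Suc j + t * K ^ Suc j"
          unfolding eq using True t0 Suc.IH[of "Suc j"] by (intro add_mono mult_left_mono) auto
        then show ?thesis using Suc by (simp add: algebra_simps)
      next
        case False
        \<comment> \<open>The coefficient \<open>1 - t\<close> is negative, so its term may be dropped; nonzero moments
          only occur for \<open>k \<le> n + 2\<close>, which keeps \<open>t\<close> bounded.\<close>
        show ?thesis
        proof (cases "k > Suc (Suc n)")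
          case True
          then show ?thesis using K1 by (simp add: moment_eq_0)
        next
          case k: False
          have "\<alpha> * real (Suc j) \<le> 2 * weight n"
          proof -
            \<comment> \<open>Here j + 1 = k \<le> n + 2 \<le> 2 (n + 1).\<close>
            have "real (Suc j) \<le> 2 * real (Suc n)" using k Suc by simp
            then have "\<alpha> * real (Suc j) \<le> \<alpha> * (2 * real (Suc n))"
              using alpha_pos by (intro mult_left_mono) auto
            then show ?thesis using gamma_nonneg by (simp add: weight_def algebra_simps)
          qed
          then have "t \<le> 2 * \<beta> / \<alpha>"
            using alpha_pos beta_pos weight_pos[of n] unfolding t_def
            by (simp add: divide_simps) (simp add: mult.commute mult.left_commute)
          have "(1 - t) * moment n (Suc j) \<le> 0"
            using False moment_nonneg by (intro mult_nonpos_nonneg) auto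
          then have "moment (Suc n) (Suc j) \<le> t * (c * moment n j)" unfolding eq by simp
          also have "\<dots> \<le> t * (C * K ^ j)" using cm t0 by (rule mult_left_mono)
          also have "\<dots> \<le> 2 * \<beta> / \<alpha> * (C * K ^ j)"
            using \<open>t \<le> 2 * \<beta> / \<alpha>\<close> C K1 by (intro mult_right_mono) auto
          also have "\<dots> = (2 * \<beta> / \<alpha> * C) * K ^ j" by simp
          also have "\<dots> \<le> K * K ^ j" using CK(2) K1 by (intro mult_right_mono) auto
          finally show ?thesis using Suc by simp
        qed
      qed
    qed
  qed
qed

text \<open>The stationary solution of \<open>moment_Suc\<close>: (\<gamma>'/\<beta>)^k / k! if
  \<beta>' = 0, and otherwise (\<beta>'/\<beta>)^k times the generalised binomial coefficient of
  \<gamma>'/\<beta>' over k.\<close>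

primrec moment_limit :: "nat \<Rightarrow> real" where
  "moment_limit 0 = 1"
| "moment_limit (Suc k) = (\<gamma>' - \<beta>' * real k) / (\<beta> * real (Suc k)) * moment_limit k"

text \<open>Comparison with the harmonic series. This divergence is what makes the moments forget
  \<open>Q 0\<close>.\<close>

lemma not_summable_inverse_weight: "\<not> summable (\<lambda>n. 1 / weight n)"
proof
  assume "summable (\<lambda>n. 1 / weight n)"
  then have sum: "summable (\<lambda>n. (\<alpha> + \<gamma>) * (1 / weight n))" by (rule summable_mult)
  have le: "norm (inverse (real (Suc n))) \<le> (\<alpha> + \<gamma>) * (1 / weight n)" for n
  proof -
    have "weight n \<le> (\<alpha> + \<gamma>) * real (Suc n)"
      using gamma_nonneg by (simp add: weight_def algebra_simps)
    then have "1 / real (Suc n) \<le> (\<alpha> + \<gamma>) / weight n"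
      using weight_pos[of n] by (simp add: pos_divide_le_eq pos_le_divide_eq del: of_nat_Suc)
    then show ?thesis by (simp add: inverse_eq_divide del: of_nat_Suc)
  qed
  have "summable (\<lambda>n. inverse (real (Suc n)))"
    by (rule summable_comparison_test'[OF sum le])
  then show False
    using not_summable_harmonic[where ?'a = real] summable_Suc_iff[of "\<lambda>n. inverse (real n)"]
    by blast
qed

lemma inverse_weight_tendsto_0: "(\<lambda>n. 1 / weight n) \<longlonglongrightarrow> 0"
proof -
  have "filterlim (\<lambda>n. real (Suc n)) at_top sequentially"
    by (rule filterlim_compose[OF filterlim_real_sequentially filterlim_Suc])
  then have "filterlim (\<lambda>n. \<gamma> + \<alpha> * real (Suc n)) at_top sequentially"
    using alpha_pos
    by (intro filterlim_tendsto_add_at_top[OF tendsto_const]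
        filterlim_tendsto_pos_mult_at_top[OF tendsto_const])
  then show ?thesis
    unfolding weight_def by (intro tendsto_divide_0[OF tendsto_const] filterlim_at_top_imp_at_infinity)
      (simp add: add.commute)
qed

text \<open>By induction on the order, \<open>moment_Suc\<close> is a relaxation with step
  \<open>t\<close> towards the target \<open>u\<close>, which is a constant multiple of the already
  convergent moment of order \<open>k\<close>.\<close>

lemma moment_tendsto: "(\<lambda>n. moment n k) \<longlonglongrightarrow> moment_limit k"
proof (induction k)
  case 0
  then show ?case by (simp add: moment_0)
next
  case (Suc k)
  define t where "t = (\<lambda>n. \<beta> * real (Suc k) * (1 / weight n))"
  define u where "u = (\<lambda>n. (\<gamma>' - \<beta>' * real k) / (\<beta> * real (Suc k)) * moment n k)"
  show ?case
  proof (rule relaxation_tendsto[where t = t and u = u])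
    show "moment (Suc n) (Suc k) = (1 - t n) * moment n (Suc k) + t n * u n" for n
    proof -
      have "t n * u n = (\<gamma>' - \<beta>' * real k) / weight n * moment n k"
        using beta_pos by (simp add: t_def u_def del: of_nat_Suc)
      then show ?thesis using weight_pos[of n]
        by (simp add: moment_Suc t_def field_simps del: of_nat_Suc)
    qed
    show "t n \<ge> 0" for n using beta_pos weight_pos[of n] by (simp add: t_def)
    show "t \<longlonglongrightarrow> 0"
      unfolding t_def by (rule tendsto_mult_right_zero[OF inverse_weight_tendsto_0])
    show "\<not> summable t"
      using not_summable_inverse_weight beta_pos unfolding t_def by (subst summable_cmult_iff) auto
    show "u \<longlonglongrightarrow> moment_limit (Suc k)"
      unfolding u_def moment_limit.simps by (intro tendsto_mult_left Suc)
  qed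
qed

lemma moment_limit_nonneg: "moment_limit k \<ge> 0"
  by (rule tendsto_lowerbound[OF moment_tendsto]) (auto simp: moment_nonneg)

text \<open>The means of the distributions with generating functions \<open>Q n\<close> tend to
  \<gamma>'/\<beta>, so the sign of \<gamma>' follows from the nonnegativity of the
  coefficients.\<close>

lemma gamma'_nonneg: "\<gamma>' \<ge> 0"
  using moment_limit_nonneg[of 1] beta_pos by (simp add: zero_le_divide_iff)

lemma pgf_defect_tendsto_0: "(\<lambda>n. coeff (pgf_defect \<beta> \<beta>' \<gamma>' (Q n)) k) \<longlonglongrightarrow> 0"
proof -
  obtain K where K: "K \<ge> 1" and mb: "\<And>n k. moment n k \<le> K ^ k"
    using moment_bound by blast
  define B where "B = \<bar>\<beta> - \<beta>'\<bar> + \<bar>\<beta>'\<bar> + \<bar>\<gamma>'\<bar>"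
  show ?thesis
  \<comment> \<open>The factors of order \<open>Suc k\<close> in the defect are absorbed by
    \<open>2 ^ k\<close>, which doubles the rate \<open>K\<close>; \<open>B\<close> bounds what
    remains of both of its coefficients on \<open>{0..1}\<close>.\<close>
  proof (rule taylor_coeff_tendsto_0_transport[where K = "2 * K" and C = "2 * B * K"])
    show "2 * K > 0" using K by simp
  next
    fix n v k assume v: "v \<in> {0..1::real}"
    let ?c = "\<lambda>k. coeff (pcompose (Q n) [:v, 1:]) k"
    have c: "\<bar>?c k\<bar> \<le> K ^ k" for k
      using shift_nonneg[of v n k] shift_le_moment[OF v, of n k] mb[of n k] v by simp
    have "\<bar>\<beta> - \<beta>' + \<beta>' * v\<bar> \<le> \<bar>\<beta> - \<beta>'\<bar> + \<bar>\<beta>'\<bar> * 1"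
      using v by (intro order_trans[OF abs_triangle_ineq] add_mono)
        (auto simp: abs_mult intro: mult_left_le)
    then have coef1: "\<bar>\<beta> - \<beta>' + \<beta>' * v\<bar> \<le> B" by (simp add: B_def)
    have "\<bar>\<beta>' * real k - \<gamma>'\<bar> \<le> \<bar>\<beta>'\<bar> * real (Suc k) + \<bar>\<gamma>'\<bar> * real (Suc k)"
      by (intro order_trans[OF abs_triangle_ineq4] add_mono) (auto simp: abs_mult algebra_simps)
    also have "\<dots> \<le> B * real (Suc k)"
      by (simp add: B_def distrib_right[symmetric] mult_right_mono del: of_nat_Suc)
    finally have coef2: "\<bar>\<beta>' * real k - \<gamma>'\<bar> \<le> B * real (Suc k)" .
    have B0: "B \<ge> 0" by (simp add: B_def)
    have "\<bar>coeff (pcompose (pgf_defect \<beta> \<beta>' \<gamma>' (Q n)) [:v, 1:]) k\<bar>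
        \<le> \<bar>\<beta> - \<beta>' + \<beta>' * v\<bar> * real (Suc k) * \<bar>?c (Suc k)\<bar> + \<bar>\<beta>' * real k - \<gamma>'\<bar> * \<bar>?c k\<bar>"
      unfolding coeff_pgf_defect_shift
      by (intro order_trans[OF abs_triangle_ineq]) (simp add: abs_mult)
    also have "\<dots> \<le> B * real (Suc k) * K ^ Suc k + B * real (Suc k) * K ^ Suc k"
    proof (intro add_mono mult_mono coef1 coef2 c)
      show "\<bar>?c k\<bar> \<le> K ^ Suc k"
        by (rule order_trans[OF c]) (use K in \<open>simp add: mult_left_le\<close>)
    qed (use B0 K in auto)
    also have "\<dots> = 2 * B * K * K ^ k * real (Suc k)" by simp
    also have "\<dots> \<le> 2 * B * K * K ^ k * 2 ^ k"
    proof (intro mult_left_mono)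
      have "Suc k \<le> 2 ^ k" by (simp add: Suc_leI)
      then show "real (Suc k) \<le> 2 ^ k"
        using of_nat_mono[of "Suc k" "2 ^ k", where ?'a = real] by simp
    qed (use B0 K in auto)
    finally show "\<bar>coeff (pcompose (pgf_defect \<beta> \<beta>' \<gamma>' (Q n)) [:v, 1:]) k\<bar> \<le> 2 * B * K * (2 * K) ^ k"
      by (simp add: power_mult_distrib mult_ac)
  next
    fix k
    have "(\<lambda>n. coeff (pcompose (pgf_defect \<beta> \<beta>' \<gamma>' (Q n)) [:1, 1:]) k) \<longlonglongrightarrow>
        \<beta> * real (Suc k) * moment_limit (Suc k) + (\<beta>' * real k - \<gamma>') * moment_limit k"
      unfolding coeff_pgf_defect_shift moment_def[symmetric]
      by (simp del: moment_limit.simps of_nat_Suc) (intro tendsto_intros moment_tendsto)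
    also have "\<beta> * real (Suc k) * moment_limit (Suc k) + (\<beta>' * real k - \<gamma>') * moment_limit k = 0"
    proof -
      have "\<beta> * real (Suc k) * moment_limit (Suc k) = (\<gamma>' - \<beta>' * real k) * moment_limit k"
        using beta_pos by (simp del: of_nat_Suc)
      then show ?thesis by (simp add: algebra_simps del: moment_limit.simps of_nat_Suc)
    qed
    finally show "(\<lambda>n. coeff (pcompose (pgf_defect \<beta> \<beta>' \<gamma>' (Q n)) [:1, 1:]) k) \<longlonglongrightarrow> 0" .
  qed
qed

section \<open>Tightness and identification of the limit\<close>

lemma sum_coeff_le_1: "(\<Sum>k\<le>N. coeff (Q n) k) \<le> 1"
proof -
  have "(\<Sum>k\<le>N. coeff (Q n) k) \<le> (\<Sum>k\<le>max N (degree (Q n)). coeff (Q n) k)"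
    by (intro sum_mono2) (auto simp: coeff_nonneg)
  also have "\<dots> = (\<Sum>k\<le>degree (Q n). coeff (Q n) k)"
    by (intro sum.mono_neutral_right) (auto simp: coeff_eq_0)
  also have "\<dots> = 1"
    using poly_1[of n] by (simp add: poly_altdef)
  finally show ?thesis .
qed

text \<open>Markov's inequality: the means \<open>moment n 1\<close> are bounded by \<open>K\<close>
  uniformly in \<open>n\<close>.\<close>

lemma coeff_tight:
  assumes "\<epsilon> > 0"
  obtains N0 where "\<And>N n. N \<ge> N0 \<Longrightarrow> (\<Sum>k\<le>N. coeff (Q n) k) \<ge> 1 - \<epsilon>"
proof -
  obtain K where K: "K \<ge> 1" and mb: "\<And>n k. moment n k \<le> K ^ k"
    using moment_bound by blast
  obtain N0 :: nat where N0: "real N0 > K / \<epsilon>" using reals_Archimedean2 by blast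
  show thesis
  proof
    fix N n assume N: "N \<ge> N0"
    let ?p = "coeff (Q n)" and ?d = "degree (Q n)"
    have "1 - (\<Sum>k\<in>{..?d} \<inter> {..N}. ?p k) = (\<Sum>k\<le>?d. ?p k) - (\<Sum>k\<in>{..?d} \<inter> {..N}. ?p k)"
      using poly_1[of n] by (simp add: poly_altdef)
    also have "\<dots> = (\<Sum>k\<in>{..?d} - {..N}. ?p k)"
      by (subst sum_diff[symmetric]) (auto intro!: sum.cong)
    also have "\<dots> \<le> (\<Sum>k\<in>{..?d} - {..N}. ?p k * real k / real (Suc N))"
    proof (intro sum_mono)
      fix k assume "k \<in> {..?d} - {..N}"
      then have "?p k * real (Suc N) \<le> ?p k * real k"
        by (intro mult_left_mono coeff_nonneg) auto
      then show "?p k \<le> ?p k * real k / real (Suc N)" by (simp add: field_simps)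
    qed
    also have "\<dots> \<le> (\<Sum>k\<le>?d. ?p k * real k / real (Suc N))"
      by (intro sum_mono2) (auto intro!: divide_nonneg_nonneg mult_nonneg_nonneg coeff_nonneg)
    also have "\<dots> = moment n 1 / real (Suc N)"
      by (simp add: moment_def coeff_pcompose_shift sum_divide_distrib)
    also have "\<dots> \<le> K / real (Suc N)"
      using mb[of n 1] by (intro divide_right_mono) auto
    also have "\<dots> \<le> \<epsilon>"
      using N0 N assms by (simp add: field_simps) (smt (verit) mult_left_mono of_nat_mono)
    finally have "1 - \<epsilon> \<le> (\<Sum>k\<in>{..?d} \<inter> {..N}. ?p k)" by simp
    also have "\<dots> \<le> (\<Sum>k\<le>N. ?p k)"
      by (intro sum_mono2) (auto simp: coeff_nonneg)
    finally show "(\<Sum>k\<le>N. ?p k) \<ge> 1 - \<epsilon>" .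
  qed
qed

text \<open>The recurrence determines \<open>pmf \<pi>\<close> up to the factor
  \<open>pmf \<pi> 0\<close>. The coefficients of \<open>Q n\<close> obey it up to the vanishing
  defect, so they are asymptotically \<open>w k\<close> times \<open>coeff (Q n) 0\<close>;
  tightness then forces \<open>coeff (Q n) 0\<close> to tend to \<open>pmf \<pi> 0\<close>.\<close>

lemma coeff_tendsto_pmf:
  fixes \<pi> :: "nat pmf"
  assumes ne: "\<beta> \<noteq> \<beta>'"
    and \<pi>: "\<And>k. (\<beta> - \<beta>') * real (Suc k) * pmf \<pi> (Suc k) = (\<gamma>' - \<beta>' * real k) * pmf \<pi> k"
  shows "(\<lambda>n. coeff (Q n) k) \<longlonglongrightarrow> pmf \<pi> k"
proof -
  let ?r = "\<lambda>k. (\<gamma>' - \<beta>' * real k) / ((\<beta> - \<beta>') * real (Suc k))"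
  have \<pi>_Suc: "pmf \<pi> (Suc k) = ?r k * pmf \<pi> k" for k
  proof -
    have d: "(\<beta> - \<beta>') * real (Suc k) \<noteq> 0" using ne by simp
    have "pmf \<pi> (Suc k) = (\<gamma>' - \<beta>' * real k) * pmf \<pi> k / ((\<beta> - \<beta>') * real (Suc k))"
      unfolding nonzero_eq_divide_eq[OF d] using \<pi>[of k] by (simp only: mult.commute)
    then show ?thesis by simp
  qed
  have p_Suc: "coeff (Q n) (Suc k) = ?r k * coeff (Q n) k
      + coeff (pgf_defect \<beta> \<beta>' \<gamma>' (Q n)) k / ((\<beta> - \<beta>') * real (Suc k))" for n k
  proof -
    have d: "(\<beta> - \<beta>') * real (Suc k) \<noteq> 0" using ne by simp
    have "coeff (Q n) (Suc k) * ((\<beta> - \<beta>') * real (Suc k))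
        = (\<gamma>' - \<beta>' * real k) * coeff (Q n) k + coeff (pgf_defect \<beta> \<beta>' \<gamma>' (Q n)) k"
      by (simp add: coeff_pgf_defect algebra_simps)
    then have "coeff (Q n) (Suc k) = ((\<gamma>' - \<beta>' * real k) * coeff (Q n) k
        + coeff (pgf_defect \<beta> \<beta>' \<gamma>' (Q n)) k) / ((\<beta> - \<beta>') * real (Suc k))"
      by (simp only: nonzero_eq_divide_eq[OF d])
    then show ?thesis by (simp only: add_divide_distrib times_divide_eq_left)
  qed
  \<comment> \<open>Otherwise the recurrence makes every point mass 0, against total mass 1.\<close>
  have "pmf \<pi> 0 \<noteq> 0"
  proof
    assume "pmf \<pi> 0 = 0"
    then have "pmf \<pi> k = 0" for k by (induction k) (simp_all only: \<pi>_Suc mult_zero_right)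
    then have "pmf \<pi> = (\<lambda>_. 0)" by (rule ext)
    then have "(\<lambda>_. 0) sums (1 :: real)"
      using pmf_nat_sums[of \<pi>] by simp
    then show False
      using sums_unique2[OF sums_zero] zero_neq_one by blast
  qed
  then have \<pi>0: "pmf \<pi> 0 > 0" using pmf_nonneg[of \<pi> 0] by linarith
  define w where "w = (\<lambda>k. pmf \<pi> k / pmf \<pi> 0)"
  have ratio: "(\<lambda>n. coeff (Q n) k - w k * coeff (Q n) 0) \<longlonglongrightarrow> 0" for k
  proof (induction k)
    case 0
    then show ?case using \<pi>0 by (simp add: w_def)
  next
    case (Suc k)
    have "(\<lambda>n. ?r k * (coeff (Q n) k - w k * coeff (Q n) 0)
        + coeff (pgf_defect \<beta> \<beta>' \<gamma>' (Q n)) k / ((\<beta> - \<beta>') * real (Suc k)))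
        \<longlonglongrightarrow> ?r k * 0 + 0 / ((\<beta> - \<beta>') * real (Suc k))"
      using ne by (intro tendsto_intros Suc pgf_defect_tendsto_0) auto
    also have "(\<lambda>n. ?r k * (coeff (Q n) k - w k * coeff (Q n) 0)
        + coeff (pgf_defect \<beta> \<beta>' \<gamma>' (Q n)) k / ((\<beta> - \<beta>') * real (Suc k)))
        = (\<lambda>n. coeff (Q n) (Suc k) - w (Suc k) * coeff (Q n) 0)"
    proof -
      have w_Suc: "w (Suc k) = ?r k * w k"
        unfolding w_def \<pi>_Suc by (simp only: times_divide_eq_right)
      have "r * (a - b * x) + d = r * a + d - r * b * x" for r a b x d :: real
        by (simp add: algebra_simps)
      then show ?thesis unfolding p_Suc w_Suc by blast
    qed
    finally show ?case by simp
  qed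
  have p0: "(\<lambda>n. coeff (Q n) 0) \<longlonglongrightarrow> pmf \<pi> 0"
  proof (rule LIMSEQ_I)
    fix r :: real assume r: "r > 0"
    \<comment> \<open>The errors below add up to \<open>3 * \<epsilon>\<close>: one each from the
      tail of \<open>Q n\<close>, from \<open>E n\<close> and from the tail of
      \<open>\<pi>\<close>.\<close>
    define \<epsilon> where "\<epsilon> = r / 4"
    have \<epsilon>: "\<epsilon> > 0" using r by (simp add: \<epsilon>_def)
    obtain N0 where N0: "\<And>N n. N \<ge> N0 \<Longrightarrow> (\<Sum>k\<le>N. coeff (Q n) k) \<ge> 1 - \<epsilon>"
      using coeff_tight[OF \<epsilon>] by blast
    have "(\<lambda>N. \<Sum>k\<le>N. pmf \<pi> k) \<longlonglongrightarrow> 1"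
      using pmf_nat_sums[of \<pi>] by (simp add: sums_def_le)
    then have "eventually (\<lambda>N. (\<Sum>k\<le>N. pmf \<pi> k) > 1 - \<epsilon>) sequentially"
      using \<epsilon> by (intro order_tendstoD) auto
    then have "eventually (\<lambda>N. (\<Sum>k\<le>N. pmf \<pi> k) > 1 - \<epsilon> \<and> N \<ge> N0) sequentially"
      using eventually_ge_at_top[of N0] by eventually_elim simp
    then obtain N where N: "(\<Sum>k\<le>N. pmf \<pi> k) > 1 - \<epsilon>" "N \<ge> N0"
      by (auto dest: eventually_happens)
    define S where "S = (\<Sum>k\<le>N. pmf \<pi> k)"
    have S: "1 - \<epsilon> < S" "S \<le> 1"
      using N sum_le_suminf[OF sums_summable[OF pmf_nat_sums[of \<pi>]], of "{..N}"]
        sums_unique[OF pmf_nat_sums[of \<pi>]] by (auto simp: S_def)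
    define E where "E = (\<lambda>n. \<Sum>k\<le>N. coeff (Q n) k - w k * coeff (Q n) 0)"
    have "E \<longlonglongrightarrow> (\<Sum>k\<le>N. 0)" unfolding E_def by (intro tendsto_sum ratio)
    then have "eventually (\<lambda>n. \<bar>E n\<bar> < \<epsilon>) sequentially"
      using \<epsilon> by (auto simp: tendsto_iff)
    moreover have "norm (coeff (Q n) 0 - pmf \<pi> 0) < r" if E: "\<bar>E n\<bar> < \<epsilon>" for n
    proof -
      let ?x = "coeff (Q n) 0" and ?T = "\<Sum>k\<le>N. coeff (Q n) k"
      have x: "0 \<le> ?x" "?x \<le> 1" using coeff_nonneg sum_coeff_le_1[of n 0] by auto
      have T: "1 - \<epsilon> \<le> ?T" "?T \<le> 1" using N0[OF N(2)] sum_coeff_le_1 by auto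
      have "E n = ?T - ?x * S / pmf \<pi> 0"
        by (simp add: E_def S_def w_def sum_subtractf sum_distrib_left sum_divide_distrib mult.commute)
      then have "?x * S - pmf \<pi> 0 = pmf \<pi> 0 * (?T - 1 - E n)"
        using \<pi>0 by (simp add: field_simps)
      also have "\<bar>\<dots>\<bar> \<le> 1 * (2 * \<epsilon>)"
        unfolding abs_mult using \<pi>0 T E by (intro mult_mono) (auto simp: pmf_le_1)
      finally have 1: "\<bar>?x * S - pmf \<pi> 0\<bar> \<le> 2 * \<epsilon>" by simp
      have "\<bar>?x * (1 - S)\<bar> \<le> 1 * \<epsilon>"
        unfolding abs_mult using x S by (intro mult_mono) auto
      then have "\<bar>?x - ?x * S\<bar> \<le> \<epsilon>" by (simp add: algebra_simps)
      with 1 have "\<bar>?x - pmf \<pi> 0\<bar> \<le> 3 * \<epsilon>" by linarith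
      then show ?thesis using r by (simp add: \<epsilon>_def)
    qed
    ultimately show "\<exists>no. \<forall>n\<ge>no. norm (coeff (Q n) 0 - pmf \<pi> 0) < r"
      by (auto simp: eventually_sequentially)
  qed
  have "(\<lambda>n. (coeff (Q n) k - w k * coeff (Q n) 0) + w k * coeff (Q n) 0) \<longlonglongrightarrow> 0 + w k * pmf \<pi> 0"
    by (intro tendsto_intros ratio p0)
  then show ?thesis using \<pi>0 by (simp add: w_def)
qed

text \<open>If \<beta> < \<beta>', both terms of the defect coefficient of order 0 are nonpositive,
  so its vanishing in the limit forces \<open>coeff (Q n) 0\<close> to tend to 0. The recurrence
  then sends all coefficients to 0, against tightness.\<close>

lemma beta'_le_beta:
  assumes "\<gamma>' > 0"
  shows "\<beta>' \<le> \<beta>"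
proof (rule ccontr)
  assume "\<not> \<beta>' \<le> \<beta>"
  then have lt: "\<beta> < \<beta>'" by simp
  have p: "(\<lambda>n. coeff (Q n) k) \<longlonglongrightarrow> 0" for k
  proof (induction k)
    case 0
    have "(\<lambda>n. - coeff (pgf_defect \<beta> \<beta>' \<gamma>' (Q n)) 0 / \<gamma>') \<longlonglongrightarrow> - 0 / \<gamma>'"
      using assms by (intro tendsto_intros pgf_defect_tendsto_0) auto
    then have lim: "(\<lambda>n. - coeff (pgf_defect \<beta> \<beta>' \<gamma>' (Q n)) 0 / \<gamma>') \<longlonglongrightarrow> 0" by simp
    have "coeff (Q n) 0 \<le> - coeff (pgf_defect \<beta> \<beta>' \<gamma>' (Q n)) 0 / \<gamma>'" for n
    proof -
      have "(\<beta> - \<beta>') * coeff (Q n) (Suc 0) \<le> 0"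
        using lt coeff_nonneg by (intro mult_nonpos_nonneg) auto
      then show ?thesis using assms by (simp add: coeff_pgf_defect field_simps)
    qed
    then show ?case
      by (intro tendsto_sandwich[OF _ _ tendsto_const lim]) (auto simp: coeff_nonneg)
  next
    case (Suc k)
    have "(\<lambda>n. (coeff (pgf_defect \<beta> \<beta>' \<gamma>' (Q n)) k - (\<beta>' * real k - \<gamma>') * coeff (Q n) k)
        / ((\<beta> - \<beta>') * real (Suc k))) \<longlonglongrightarrow> (0 - (\<beta>' * real k - \<gamma>') * 0) / ((\<beta> - \<beta>') * real (Suc k))"
      using lt by (intro tendsto_intros Suc pgf_defect_tendsto_0) auto
    moreover have "(coeff (pgf_defect \<beta> \<beta>' \<gamma>' (Q n)) k - (\<beta>' * real k - \<gamma>') * coeff (Q n) k)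
        / ((\<beta> - \<beta>') * real (Suc k)) = coeff (Q n) (Suc k)" for n
      using lt unfolding coeff_pgf_defect add_diff_cancel_right' by (simp del: of_nat_Suc)
    ultimately show ?case by simp
  qed
  have half: "(1 / 2 :: real) > 0" by simp
  obtain N0 where N0: "\<And>N n. N \<ge> N0 \<Longrightarrow> (\<Sum>k\<le>N. coeff (Q n) k) \<ge> 1 - 1 / 2"
    using coeff_tight[OF half] by blast
  have "(\<lambda>n. \<Sum>k\<le>N0. coeff (Q n) k) \<longlonglongrightarrow> (\<Sum>k\<le>N0. 0)" by (intro tendsto_sum p)
  then have "(\<Sum>k\<le>N0. 0) \<ge> (1 - 1 / 2 :: real)"
    by (rule tendsto_lowerbound) (simp_all only: N0 order_refl eventually_True trivial_limit_sequentially not_False_eq_True)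
  then show False by simp
qed

end

subsection \<open>Random variables with values in the natural numbers\<close>

text \<open>Dominated convergence with bound 1: the partial sums integrate v^X restricted to the
  event X < i.\<close>

lemma pgf_sums:
  fixes X :: "'a \<Rightarrow> nat" and v :: real
  assumes M: "prob_space M" and X [measurable]: "X \<in> measurable M (count_space UNIV)"
    and v: "\<bar>v\<bar> \<le> 1"
  shows "(\<lambda>k. measure M {\<omega> \<in> space M. X \<omega> = k} * v ^ k) sums (\<integral>\<omega>. v ^ X \<omega> \<partial>M)"
proof -
  interpret prob_space M by (rule M)
  let ?A = "\<lambda>k. {\<omega> \<in> space M. X \<omega> = k}"
  let ?s = "\<lambda>i \<omega>. \<Sum>k<i. v ^ k * indicator (?A k) \<omega>"
  have A [measurable]: "?A k \<in> sets M" for k by measurable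
  have s: "?s i \<omega> = (if X \<omega> < i then v ^ X \<omega> else 0)" if "\<omega> \<in> space M" for i \<omega>
  proof -
    have "?s i \<omega> = (\<Sum>k<i. if X \<omega> = k then v ^ k else 0)"
      using that by (intro sum.cong) (auto simp: indicator_def)
    then show ?thesis by simp
  qed
  have pow: "\<bar>v ^ k\<bar> \<le> 1" for k
    using v by (simp add: power_abs power_le_one)
  have "(\<lambda>i. \<integral>\<omega>. ?s i \<omega> \<partial>M) \<longlonglongrightarrow> (\<integral>\<omega>. v ^ X \<omega> \<partial>M)"
  proof (rule integral_dominated_convergence[where w = "\<lambda>_. 1"])
    show "AE \<omega> in M. (\<lambda>i. ?s i \<omega>) \<longlonglongrightarrow> v ^ X \<omega>"
    proof (intro AE_I2)
      fix \<omega> assume \<omega>: "\<omega> \<in> space M"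
      have "eventually (\<lambda>i. ?s i \<omega> = v ^ X \<omega>) sequentially"
        using eventually_gt_at_top[of "X \<omega>"] by eventually_elim (simp only: s[OF \<omega>] if_True)
      then show "(\<lambda>i. ?s i \<omega>) \<longlonglongrightarrow> v ^ X \<omega>" by (rule tendsto_eventually)
    qed
    show "AE \<omega> in M. norm (?s i \<omega>) \<le> 1" for i
    proof (intro AE_I2)
      fix \<omega> assume \<omega>: "\<omega> \<in> space M"
      show "norm (?s i \<omega>) \<le> 1" unfolding s[OF \<omega>] using pow[of "X \<omega>"] by simp
    qed
  qed simp_all
  moreover have "(\<integral>\<omega>. ?s i \<omega> \<partial>M) = (\<Sum>k<i. measure M (?A k) * v ^ k)" for i
  proof -
    have "integrable M (\<lambda>\<omega>. v ^ k * indicator (?A k) \<omega>)" for k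
      by (intro integrable_mult_right integrable_real_indicator) (auto simp: less_top[symmetric])
    then show ?thesis
      by (subst Bochner_Integration.integral_sum) (auto intro!: sum.cong simp: mult.commute)
  qed
  ultimately show ?thesis by (simp add: sums_def)
qed

text \<open>Both sides are coefficients of power series for the same function on the open unit
  interval around 0.\<close>

lemma prob_eq_coeff:
  fixes X :: "'a \<Rightarrow> nat" and p :: "real poly"
  assumes "prob_space M" "X \<in> measurable M (count_space UNIV)"
    and "\<And>v. \<bar>v\<bar> \<le> 1 \<Longrightarrow> (\<integral>\<omega>. v ^ X \<omega> \<partial>M) = poly p v"
  shows "measure M {\<omega> \<in> space M. X \<omega> = k} = coeff p k"
proof (rule powser_coeffs_unique[where r = 1 and f = "poly p"])
  fix x :: real assume x: "\<bar>x\<bar> < 1"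
  show "(\<lambda>k. measure M {\<omega> \<in> space M. X \<omega> = k} * x ^ k) sums poly p x"
    using pgf_sums[OF assms(1,2), of x] assms(3)[of x] x by simp
  show "(\<lambda>k. coeff p k * x ^ k) sums poly p x"
    unfolding poly_altdef by (rule sums_finite) (auto simp: coeff_eq_0)
qed simp

lemma cdf_distr_real_nat:
  fixes X :: "'a \<Rightarrow> nat"
  assumes M: "prob_space M" and X [measurable]: "X \<in> measurable M (count_space UNIV)"
  shows "cdf (distr M borel (\<lambda>\<omega>. real (X \<omega>))) x =
           (\<Sum>k | real k \<le> x. measure M {\<omega> \<in> space M. X \<omega> = k})"
proof -
  interpret prob_space M by (rule M)
  have fin: "finite {k. real k \<le> x}"
    by (rule finite_subset[of _ "{..nat \<lfloor>x\<rfloor>}"]) (auto simp: le_nat_floor)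
  have "cdf (distr M borel (\<lambda>\<omega>. real (X \<omega>))) x = measure M ((\<lambda>\<omega>. real (X \<omega>)) -` {..x} \<inter> space M)"
    unfolding cdf_def by (rule measure_distr) auto
  also have "(\<lambda>\<omega>. real (X \<omega>)) -` {..x} \<inter> space M = (\<Union>k\<in>{k. real k \<le> x}. {\<omega> \<in> space M. X \<omega> = k})"
    by auto
  also have "measure M \<dots> = (\<Sum>k | real k \<le> x. measure M {\<omega> \<in> space M. X \<omega> = k})"
    using fin by (intro finite_measure_finite_Union) (auto simp: disjoint_family_on_def)
  finally show ?thesis .
qed

text \<open>At each \<open>x\<close> the distribution function is a finite sum of point
  probabilities, so it converges everywhere, not only at continuity points of the limit.\<close>

lemma nat_converges_in_distI:
  assumes "\<And>n. prob_space (M n)" "\<And>n. X n \<in> measurable (M n) (count_space UNIV)"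
    and lim: "\<And>k. (\<lambda>n. measure (M n) {\<omega> \<in> space (M n). X n \<omega> = k}) \<longlonglongrightarrow> pmf L k"
  shows "nat_converges_in_dist M X L"
proof -
  have L: "cdf (distr (measure_pmf L) borel real) x = (\<Sum>k | real k \<le> x. pmf L k)" for x
    using cdf_distr_real_nat[OF prob_space_measure_pmf, of id L x]
    by (simp add: measure_pmf_single)
  show ?thesis
    unfolding nat_converges_in_dist_def weak_conv_m_def weak_conv_def
    by (simp add: cdf_distr_real_nat assms L tendsto_sum)
qed

section \<open>Two-term recurrences and generating functions of the limit laws\<close>

lemma bernoulli_sum_pmf_eq_binomial_pmf:
  assumes "p \<in> {0..1}"
  shows "bernoulli_sum_pmf l p = binomial_pmf l p"
proof -
  have "binomial_pmf l p = map_pmf (\<lambda>b. card {i \<in> {..<l}. b i}) (Pi_pmf {..<l} False (\<lambda>_. bernoulli_pmf p))"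
    using assms by (intro binomial_pmf_altdef') auto
  also have "(\<lambda>b. card {i \<in> {..<l}. b i}) = (\<lambda>b. \<Sum>i<l. of_bool (b i))"
    by (rule ext) (simp add: of_bool_def sum.If_cases Int_def)
  finally show ?thesis by (simp add: bernoulli_sum_pmf_def)
qed

lemma pmf_binomial_Suc:
  assumes "p \<in> {0..1}"
  shows "(1 - p) * real (Suc k) * pmf (binomial_pmf l p) (Suc k) = (real l - real k) * p * pmf (binomial_pmf l p) k"
proof -
  have ch: "real (Suc k) * real (l choose Suc k) = (real l - real k) * real (l choose k)"
    using gbinomial_mult_1[of "real l" k] by (simp add: binomial_gbinomial algebra_simps)
  show ?thesis
  proof (cases "k < l")
    case True
    then have pow: "(1 - p) ^ (l - k) = (1 - p) * (1 - p) ^ (l - Suc k)"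
      by (simp flip: power_Suc add: Suc_diff_Suc)
    have "(1 - p) * real (Suc k) * pmf (binomial_pmf l p) (Suc k)
        = (real (Suc k) * real (l choose Suc k)) * p ^ Suc k * ((1 - p) * (1 - p) ^ (l - Suc k))"
      using assms by (simp del: of_nat_Suc)
    also have "\<dots> = (real l - real k) * p * pmf (binomial_pmf l p) k"
      unfolding ch pow[symmetric] using assms by simp
    finally show ?thesis .
  next
    \<comment> \<open>Both sides vanish: for \<open>k = l\<close> because of the real factor
      \<open>real l - real k\<close>, beyond that because both point masses are 0.\<close>
    case False
    then show ?thesis using assms by (cases "k = l") (auto simp: binomial_eq_0)
  qed
qed

lemma pmf_real_neg_binomial_Suc:
  assumes "0 \<le> r" "0 \<le> p" "p < 1"
  shows "real (Suc k) * pmf (real_neg_binomial_pmf r p) (Suc k)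
           = (r + real k) * p * pmf (real_neg_binomial_pmf r p) k"
proof -
  have ch: "real (Suc k) * (r + real k gchoose Suc k) = (r + real k) * (r + real k - 1 gchoose k)"
    by (rule gbinomial_absorption)
  have "real (Suc k) * pmf (real_neg_binomial_pmf r p) (Suc k)
      = (real (Suc k) * (r + real k gchoose Suc k)) * (1 - p) powr r * p ^ Suc k"
    using assms by (simp add: pmf_real_neg_binomial)
  also have "\<dots> = (r + real k) * p * pmf (real_neg_binomial_pmf r p) k"
    unfolding ch using assms by (simp add: pmf_real_neg_binomial)
  finally show ?thesis .
qed

text \<open>The generalised binomial series at \<open>- (p * v)\<close>, with the upper index of the
  binomial coefficients negated.\<close>

lemma real_neg_binomial_pgf:
  assumes "0 \<le> r" "0 \<le> p" "p < 1" "\<bar>v\<bar> \<le> 1"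
  shows "measure_pmf.expectation (real_neg_binomial_pmf r p) (\<lambda>k. v ^ k)
           = ((1 - p * v) / (1 - p)) powr (- r)"
proof -
  have "\<bar>p * v\<bar> \<le> p * 1" unfolding abs_mult using assms by (intro mult_mono) auto
  then have pv: "\<bar>- (p * v)\<bar> < 1" using assms by simp
  have "(\<lambda>k. ((- r) gchoose k) * (- (p * v)) ^ k) sums (1 + (- (p * v))) powr (- r)"
    by (rule gen_binomial_real[OF pv])
  also have "(\<lambda>k. ((- r) gchoose k) * (- (p * v)) ^ k) = (\<lambda>k. ((r + real k - 1) gchoose k) * (p * v) ^ k)"
    by (rule ext) (simp add: gbinomial_minus power_minus[of "p * v"])
  finally have "(\<lambda>k. (1 - p) powr r * (((r + real k - 1) gchoose k) * (p * v) ^ k)) sums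
      ((1 - p) powr r * (1 - p * v) powr (- r))"
    by (intro sums_mult) simp
  moreover have "(\<lambda>k. pmf (real_neg_binomial_pmf r p) k * v ^ k) sums
      measure_pmf.expectation (real_neg_binomial_pmf r p) (\<lambda>k. v ^ k)"
    using pgf_sums[OF prob_space_measure_pmf, of id "real_neg_binomial_pmf r p" v] assms(4)
    by (simp add: measure_pmf_single)
  ultimately have "measure_pmf.expectation (real_neg_binomial_pmf r p) (\<lambda>k. v ^ k)
      = (1 - p) powr r * (1 - p * v) powr (- r)"
    using assms by (intro sums_unique2) (auto simp: pmf_real_neg_binomial power_mult_distrib mult_ac)
  also have "\<dots> = ((1 - p * v) / (1 - p)) powr (- r)"
    using assms pv by (simp add: powr_divide powr_minus field_simps)
  finally show ?thesis .
qed

subsection \<open>Limit laws\<close>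

text \<open>The parameter ranges are part of the conclusions, since the limit laws have their
  intended meaning only there.\<close>

theorem mainTheorem15:
  fixes \<alpha> \<beta> \<gamma> \<beta>' \<gamma>' c0 c1 :: real
    and e :: "nat \<Rightarrow> real"
    and P :: "nat \<Rightarrow> real poly"
    and M :: "nat \<Rightarrow> 'a measure"
    and X :: "nat \<Rightarrow> 'a \<Rightarrow> nat"
  assumes "\<alpha> > 0" and "\<gamma> \<ge> 0" and "c0 > 0"
    and "\<And>n. n \<ge> 1 \<Longrightarrow> e n \<noteq> 0"
    and "P 0 = [:c0:] + smult c1 [:-1, 1:]"
    and "\<And>n. n \<ge> 1 \<Longrightarrow>
           P n = smult (1 / e n) (([:\<alpha> * real n + \<gamma>:] + smult \<gamma>' [:-1, 1:]) * P (n - 1))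
               + smult (1 / e n) (([:\<beta>:] + smult \<beta>' [:-1, 1:]) * [:1, -1:] * pderiv (P (n - 1)))"
    and "\<And>n k. coeff (P n) k \<ge> 0"
    and "\<And>n. poly (P n) 1 > 0"
    and "\<beta> > 0"
    and "\<And>n. prob_space (M n)"
    and "\<And>n. X n \<in> measurable (M n) (count_space UNIV)"
    and "\<And>n v. \<bar>v\<bar> \<le> 1 \<Longrightarrow> (\<integral>\<omega>. v ^ X n \<omega> \<partial>M n) = poly (P n) v / poly (P n) 1"
  shows "(\<beta>' = 0 \<longrightarrow>
            \<gamma>' / \<beta> \<ge> 0 \<and> nat_converges_in_dist M X (poisson0_pmf (\<gamma>' / \<beta>)))
       \<and> (\<beta>' < 0 \<longrightarrow>
            - \<gamma>' / \<beta>' \<ge> 0 \<and> - \<beta>' / (\<beta> - \<beta>') \<in> {0<..<1} \<and>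
            nat_converges_in_dist M X
              (real_neg_binomial_pmf (- \<gamma>' / \<beta>') (- \<beta>' / (\<beta> - \<beta>'))) \<and>
            (\<forall>v. \<bar>v\<bar> \<le> 1 \<longrightarrow>
               measure_pmf.expectation
                 (real_neg_binomial_pmf (- \<gamma>' / \<beta>') (- \<beta>' / (\<beta> - \<beta>'))) (\<lambda>k. v ^ k)
               = (1 + \<beta>' / \<beta> * (v - 1)) powr (\<gamma>' / \<beta>')))
       \<and> (\<forall>l::nat. \<beta>' > 0 \<and> \<beta> \<noteq> \<beta>' \<and> l \<ge> 1 \<and> \<gamma>' = real l * \<beta>' \<longrightarrow>
            \<beta>' / \<beta> \<in> {0..1} \<and>
            nat_converges_in_dist M X (bernoulli_sum_pmf l (\<beta>' / \<beta>)))"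
proof -
  define Q where "Q = (\<lambda>n. smult (1 / poly (P n) 1) (P n))"
  have P_step: "poly (P (Suc n)) x =
      ((\<alpha> * real (Suc n) + \<gamma> + \<gamma>' * (x - 1)) * poly (P n) x
        + (\<beta> + \<beta>' * (x - 1)) * (1 - x) * poly (pderiv (P n)) x) / e (Suc n)" for n x
    by (subst assms(6)) (simp_all add: divide_inverse algebra_simps)
  have Q_step: "Q (Suc n) = Q n + smult (1 / (\<alpha> * real (Suc n) + \<gamma>))
      ([:1, -1:] * pgf_defect \<beta> \<beta>' \<gamma>' (Q n))" for n
  proof -
    define W where "W = \<alpha> * real (Suc n) + \<gamma>"
    have W: "W > 0" using assms(1,2) by (simp add: W_def add_pos_nonneg)
    have S: "poly (P n) 1 > 0" and e: "e (Suc n) \<noteq> 0" using assms(8) assms(4) by simp_all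
    \<comment> \<open>At 1 the derivative term vanishes. Dividing by this value cancels
      \<open>e (Suc n)\<close> from the recurrence.\<close>
    have S': "poly (P (Suc n)) 1 = W * poly (P n) 1 / e (Suc n)"
      unfolding P_step W_def by simp
    have "poly (Q (Suc n)) x = poly (Q n + smult (1 / W) ([:1, -1:] * pgf_defect \<beta> \<beta>' \<gamma>' (Q n))) x" for x
    proof -
      define A B where "A = poly (P n) x" and "B = poly (pderiv (P n)) x"
      have "poly (Q (Suc n)) x = ((W + \<gamma>' * (x - 1)) * A
          + (\<beta> + \<beta>' * (x - 1)) * (1 - x) * B) / e (Suc n) / poly (P (Suc n)) 1"
        by (simp add: Q_def P_step[of n x] W_def A_def B_def)
      also have "\<dots> = ((W + \<gamma>' * (x - 1)) * A + (\<beta> + \<beta>' * (x - 1)) * (1 - x) * B)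
          / (W * poly (P n) 1)"
        unfolding S' using e by simp
      also have "\<dots> = A / poly (P n) 1 + 1 / W * ((1 - x) *
          ((\<beta> - \<beta>' + \<beta>' * x) * (B / poly (P n) 1) - \<gamma>' * (A / poly (P n) 1)))"
        using W S by (simp add: divide_simps) (simp add: algebra_simps)
      also have "\<dots> = poly (Q n + smult (1 / W) ([:1, -1:] * pgf_defect \<beta> \<beta>' \<gamma>' (Q n))) x"
        by (simp add: Q_def pgf_defect_def pderiv_smult A_def B_def divide_inverse algebra_simps)
      finally show ?thesis .
    qed
    then show ?thesis
      unfolding W_def[symmetric] by (intro poly_eq_poly_eq_iff[THEN iffD1] ext)
  qed
  interpret pgf_recurrence \<alpha> \<beta> \<gamma> \<beta>' \<gamma>' Q
  proof
    show "degree (Q 0) \<le> 1"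
      unfolding Q_def assms(5)
      by (intro order_trans[OF degree_smult_le] degree_add_le) auto
    show "coeff (Q n) k \<ge> 0" for n k
      using assms(7)[of n k] assms(8)[of n] by (simp add: Q_def)
    show "poly (Q n) 1 = 1" for n
      using assms(8)[of n] by (simp add: Q_def)
  qed (use assms Q_step in auto)
  have prob: "measure (M n) {\<omega> \<in> space (M n). X n \<omega> = k} = coeff (Q n) k" for n k
    by (rule prob_eq_coeff[OF assms(10,11)]) (simp add: assms(12) Q_def)
  have conv: "nat_converges_in_dist M X \<pi>"
    if "\<beta> \<noteq> \<beta>'"
      and "\<And>k. (\<beta> - \<beta>') * real (Suc k) * pmf \<pi> (Suc k) = (\<gamma>' - \<beta>' * real k) * pmf \<pi> k" for \<pi>
    by (rule nat_converges_in_distI[OF assms(10,11)]) (unfold prob, rule coeff_tendsto_pmf[OF that])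
  show ?thesis
  proof (intro conjI impI allI)
    assume \<beta>': "\<beta>' = 0"
    show nn: "\<gamma>' / \<beta> \<ge> 0" using gamma'_nonneg assms(9) by simp
    have "\<beta> * real (Suc k) * pmf (poisson0_pmf (\<gamma>' / \<beta>)) (Suc k)
        = \<gamma>' * pmf (poisson0_pmf (\<gamma>' / \<beta>)) k" for k
      using assms(9) by (simp add: pmf_poisson0[OF nn] del: of_nat_Suc)
    then show "nat_converges_in_dist M X (poisson0_pmf (\<gamma>' / \<beta>))"
      using assms(9) \<beta>' by (intro conv) (simp_all del: of_nat_Suc)
  next
    assume \<beta>': "\<beta>' < 0"
    define r p where "r = - \<gamma>' / \<beta>'" and "p = - \<beta>' / (\<beta> - \<beta>')"
    have r: "r \<ge> 0" using gamma'_nonneg \<beta>' by (simp add: r_def divide_nonneg_neg)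
    have p: "0 < p" "p < 1" using \<beta>' assms(9) by (simp_all add: p_def field_simps)
    show "- \<gamma>' / \<beta>' \<ge> 0" "- \<beta>' / (\<beta> - \<beta>') \<in> {0<..<1}"
      using r p by (simp_all add: r_def p_def)
    \<comment> \<open>Since (\<beta> - \<beta>') p = -\<beta>' and -\<beta>' r = \<gamma>', the
      negative binomial recurrence becomes the one required by \<open>conv\<close>.\<close>
    have coef: "(\<beta> - \<beta>') * ((r + real k) * p) = \<gamma>' - \<beta>' * real k" for k
      using \<beta>' assms(9) by (simp add: r_def p_def field_simps)
    have "(\<beta> - \<beta>') * real (Suc k) * pmf (real_neg_binomial_pmf r p) (Suc k)
        = (\<gamma>' - \<beta>' * real k) * pmf (real_neg_binomial_pmf r p) k" for k
    proof -
      have "(\<beta> - \<beta>') * real (Suc k) * pmf (real_neg_binomial_pmf r p) (Suc k)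
          = (\<beta> - \<beta>') * ((r + real k) * p) * pmf (real_neg_binomial_pmf r p) k"
        using pmf_real_neg_binomial_Suc[of r p k] r p by (simp only: mult.assoc less_imp_le)
      then show ?thesis by (simp only: coef)
    qed
    then have "nat_converges_in_dist M X (real_neg_binomial_pmf r p)"
      using \<beta>' assms(9) by (intro conv) auto
    then show "nat_converges_in_dist M X
        (real_neg_binomial_pmf (- \<gamma>' / \<beta>') (- \<beta>' / (\<beta> - \<beta>')))"
      by (simp only: r_def p_def)
    fix v :: real assume v: "\<bar>v\<bar> \<le> 1"
    have "(1 - p * v) / (1 - p) = 1 + \<beta>' / \<beta> * (v - 1)"
    proof -
      have num: "1 - p * v = (\<beta> - \<beta>' + \<beta>' * v) / (\<beta> - \<beta>')"
        and den: "1 - p = \<beta> / (\<beta> - \<beta>')"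
        using \<beta>' assms(9) by (simp_all add: p_def field_simps)
      show ?thesis
        unfolding num den using \<beta>' assms(9) by (simp add: field_simps)
    qed
    moreover have "- r = \<gamma>' / \<beta>'" by (simp add: r_def)
    ultimately have "measure_pmf.expectation (real_neg_binomial_pmf r p) (\<lambda>k. v ^ k)
        = (1 + \<beta>' / \<beta> * (v - 1)) powr (\<gamma>' / \<beta>')"
      using real_neg_binomial_pgf[of r p v] r p v by simp
    then show "measure_pmf.expectation
        (real_neg_binomial_pmf (- \<gamma>' / \<beta>') (- \<beta>' / (\<beta> - \<beta>'))) (\<lambda>k. v ^ k)
        = (1 + \<beta>' / \<beta> * (v - 1)) powr (\<gamma>' / \<beta>')"
      by (simp only: r_def p_def)
  next
    fix l :: nat
    assume l: "\<beta>' > 0 \<and> \<beta> \<noteq> \<beta>' \<and> l \<ge> 1 \<and> \<gamma>' = real l * \<beta>'"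
    \<comment> \<open>\<open>l \<ge> 1\<close> gives \<gamma>' > 0, as \<open>beta'_le_beta\<close>
      demands.\<close>
    then have "\<beta>' \<le> \<beta>" by (intro beta'_le_beta) simp
    then show p: "\<beta>' / \<beta> \<in> {0..1}" using l assms(9) by simp
    have "(\<beta> - \<beta>') * real (Suc k) * pmf (binomial_pmf l (\<beta>' / \<beta>)) (Suc k)
        = (\<gamma>' - \<beta>' * real k) * pmf (binomial_pmf l (\<beta>' / \<beta>)) k" for k
    proof -
      \<comment> \<open>The binomial recurrence is multiplied by \<beta>; then \<gamma>' = l
        \<beta>' turns its right-hand factor into \<gamma>' - \<beta>' k.\<close>
      have "\<beta> - \<beta>' = \<beta> * (1 - \<beta>' / \<beta>)" using assms(9) by (simp add: field_simps)
      then have "(\<beta> - \<beta>') * real (Suc k) * pmf (binomial_pmf l (\<beta>' / \<beta>)) (Suc k)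
          = \<beta> * ((real l - real k) * (\<beta>' / \<beta>) * pmf (binomial_pmf l (\<beta>' / \<beta>)) k)"
        unfolding pmf_binomial_Suc[OF p, symmetric] by (simp only: mult.assoc)
      also have "\<dots> = (\<gamma>' - \<beta>' * real k) * pmf (binomial_pmf l (\<beta>' / \<beta>)) k"
        using assms(9) l by (simp add: algebra_simps)
      finally show ?thesis .
    qed
    then show "nat_converges_in_dist M X (bernoulli_sum_pmf l (\<beta>' / \<beta>))"
      unfolding bernoulli_sum_pmf_eq_binomial_pmf[OF p] using l by (intro conv) auto
  qed
qed

end
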